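(* Let $n>1$ be an integer and let $\mathcal{C}$ denote any one of the three closed cones $\mathbb{R}^n$, $\mathcal{L}$, or $\partial(\mathcal{L})$, where $\mathcal{L}\subset\mathbb{R}^n$ is the second order cone. Then $$\mathcal{Z}(\mathcal{L})^*=\{B\in\mathbb{R}^{n\times n}:\langle B,\mathrm{I}\rangle=0,\ -JB\in\mathcal{K}_{\mathcal{C}}\}.$$ In particular, $$\{X\in\mathbb{R}^{n\times n}:\langle J,X\rangle=0,\ X\in\mathcal{S}^n_+\}=\{X\in\mathbb{R}^{n\times n}:\langle J,X\rangle=0,\ X\in\mathcal{K}_{\mathcal{C}}\}.$$
   Context: $\mathbb{R}^n$ (column vectors) carries the usual inner product $\langle\cdot,\cdot\rangle$ and norm $\|\cdot\|$; $\mathbb{R}^{n\times n}$ carries the inner product $\langle X,Y\rangle=\operatorname{tr}(X^\top Y)$. The second order cone is $\mathcal{L}=\{(t,u)^\top : t\in\mathbb{R},\ u\in\mathbb{R}^{n-1},\ t\ge\|u\|\}$; it is self-dual, i.e. $\mathcal{L}^*:=\{x\in\mathbb{R}^n:\langle x,y\rangle\ge 0\ \forall y\in\mathcal{L}\}=\mathcal{L}$. Its boundary is $\partial(\mathcal{L})=\{(t,u)^\top: t=\|u\|\}$. A matrix $A\in\mathbb{R}^{n\times n}$ is a $\mathcal{Z}$-transformation on $\mathcal{L}$ if $\langle Ax,y\rangle\le 0$ whenever $x\in\mathcal{L}$, $y\in\mathcal{L}^*=\mathcal{L}$ and $\langle x,y\rangle=0$. $\mathcal{Z}(\mathcal{L})\subseteq\mathbb{R}^{n\times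 n}$ denotes the set (a closed convex cone) of all $\mathcal{Z}$-transformations on $\mathcal{L}$, and its dual, taken in $\mathbb{R}^{n\times n}$, is $\mathcal{Z}(\mathcal{L})^*=\{B\in\mathbb{R}^{n\times n}:\langle B,A\rangle\ge 0\ \forall A\in\mathcal{Z}(\mathcal{L})\}$. $\mathrm{I}$ is the $n\times n$ identity matrix and $J=\operatorname{diag}(1,-1,-1,\ldots,-1)\in\mathbb{R}^{n\times n}$. $\mathcal{S}^n_+$ is the cone of real symmetric positive semidefinite $n\times n$ matrices. For a closed cone $\mathcal{C}\subseteq\mathbb{R}^n$ (not necessarily convex), the completely positive cone of $\mathcal{C}$ is $\mathcal{K}_{\mathcal{C}}=\{\sum uu^\top: u\in\mathcal{C}\}$, the set of all finite sums of matrices $uu^\top$ with $u\in\mathcal{C}$; its elements are symmetric matrices. (In particular $\mathcal{K}_{\mathbb{R}^n}=\mathcal{S}^n_+$.) *)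

theory Defs
  imports "HOL-Analysis.Analysis"
begin

text \<open>
  Vectors of dimension \<open>n\<close> are of type \<^typ>\<open>real ^ 'n\<close>, with \<open>n = CARD('n)\<close>. A finite index type
  has no canonical first element, so the index \<open>k :: 'n\<close> of the distinguished coordinate (the
  \<open>t\<close> in \<open>(t, u)\<close>, resp. the entry \<open>1\<close> of \<open>J\<close>) is an explicit parameter.
\<close>

definition soc :: "'n::finite \<Rightarrow> (real ^ 'n) set" where
  "soc k = {x. x $ k \<ge> L2_set (\<lambda>i. x $ i) (UNIV - {k})}"

definition soc_boundary :: "'n::finite \<Rightarrow> (real ^ 'n) set" where
  "soc_boundary k = {x. x $ k = L2_set (\<lambda>i. x $ i) (UNIV - {k})}"

definition dual_cone :: "'a::real_inner set \<Rightarrow> 'a set" where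
  "dual_cone K = {x. \<forall>y\<in>K. x \<bullet> y \<ge> 0}"

definition Z_transformations :: "(real ^ 'n) set \<Rightarrow> (real ^ 'n ^ 'n) set" where
  "Z_transformations K =
     {A. \<forall>x\<in>K. \<forall>y\<in>dual_cone K. x \<bullet> y = 0 \<longrightarrow> (A *v x) \<bullet> y \<le> 0}"

definition Jmat :: "'n::finite \<Rightarrow> real ^ 'n ^ 'n" where
  "Jmat k = (\<chi> i j. if i = j then (if i = k then 1 else - 1) else 0)"

definition psd_cone :: "(real ^ 'n ^ 'n) set" where
  "psd_cone = {X. transpose X = X \<and> (\<forall>v. v \<bullet> (X *v v) \<ge> 0)}"

definition outer :: "real ^ 'n \<Rightarrow> real ^ 'n ^ 'n" where
  "outer u = (\<chi> i j. u $ i * u $ j)"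

definition cp_cone :: "(real ^ 'n) set \<Rightarrow> (real ^ 'n ^ 'n) set" where
  "cp_cone C = {(\<Sum>l<m. outer (u l)) | (m::nat) u. \<forall>l<m. u l \<in> C}"

text \<open>The library inner product on matrices is the trace inner product.\<close>

lemma inner_matrix_eq_trace:
  fixes X Y :: "real ^ 'n ^ 'm"
  shows "X \<bullet> Y = trace (transpose X ** Y)"
  unfolding inner_vec_def trace_def transpose_def matrix_matrix_mult_def
  by (simp add: sum.swap[of _ "UNIV :: 'm set"])

text \<open>\<^const>\<open>soc_boundary\<close> is the topological boundary of \<^const>\<open>soc\<close>.\<close>

lemma frontier_soc: "frontier (soc k) = soc_boundary k"
proof -
  let ?N = "\<lambda>x :: real ^ 'a. L2_set (\<lambda>i. x $ i) (UNIV - {k})"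
  have cont: "continuous_on UNIV ?N"
    unfolding L2_set_def by (intro continuous_intros)
  have "closed (soc k)"
    unfolding soc_def by (intro closed_Collect_le cont continuous_intros)
  then have "closure (soc k) = soc k" by (rule closure_closed)
  moreover have "interior (soc k) = {x. ?N x < x $ k}"
  proof (rule interior_unique)
    show "open {x. ?N x < x $ k}"
      by (intro open_Collect_less cont continuous_intros)
    show "{x. ?N x < x $ k} \<subseteq> soc k" unfolding soc_def by (simp add: Collect_mono)
    fix T assume T: "T \<subseteq> soc k" "open T"
    show "T \<subseteq> {x. ?N x < x $ k}"
    proof
      fix x assume "x \<in> T"
      then obtain e where e: "e > 0" "cball x e \<subseteq> T"
        using T(2) open_contains_cball by blast
      let ?y = "x - axis k e"
      have "?y \<in> cball x e"
        using e(1) by (simp add: dist_norm norm_eq_sqrt_inner inner_axis_axis)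
      then have "?y \<in> soc k"
        using e(2) T(1) by blast
      then have "?N ?y \<le> ?y $ k"
        unfolding soc_def by (rule CollectD)
      moreover have "?y $ k = x $ k - e"
        by (simp add: axis_def)
      moreover have "?N ?y = ?N x"
        by (rule L2_set_cong) (auto simp: axis_def)
      ultimately have "?N x < x $ k"
        using e(1) by simp
      then show "x \<in> {x. ?N x < x $ k}" by simp
    qed
  qed
  ultimately have "frontier (soc k) = soc k - {x. ?N x < x $ k}"
    by (simp only: frontier_def)
  then show ?thesis
    unfolding soc_def soc_boundary_def by fastforce
qed

end

theory Submission
  imports Defs "HOL-Library.Quadratic_Discriminant"
begin

text \<open>
  Write \<open>X = - J B\<close>. If nonzero vectors \<open>x\<close> and \<open>y\<close> of the self-dual second order cone
  are orthogonal, then both lie on its boundary and \<open>J y\<close> is a positive multiple of \<open>x\<close>. Hence \<open>A\<close> is a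
  \<open>Z\<close>-transformation iff the quadratic form of \<open>- J A\<close> is nonnegative on the boundary
  (\<open>Z_transformations_soc_iff\<close>), and \<open>B\<close> lies in the dual of that cone iff \<open>X \<bullet> M \<ge> 0\<close> for every
  matrix \<open>M\<close> that is copositive on the boundary.

  The copositive matrices include \<open>J\<close> and \<open>- J\<close> (whose forms vanish on the boundary), all
  \<open>v v\<^sup>T\<close>, and the skew matrix \<open>X\<^sup>T - X\<close>. Testing \<open>X\<close> against just these already forces
  \<open>J \<bullet> X = 0\<close>, positive semidefiniteness and symmetry.

  Conversely, a positive semidefinite \<open>X\<close> is a sum of matrices \<open>u u\<^sup>T\<close>, and when \<open>J \<bullet> X = 0\<close> the
  summands can be rotated in pairs until every \<open>u\<close> satisfies \<open>u \<bullet> J u = 0\<close>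
  (\<open>rank_one_decomposition\<close>, due to Sturm and Zhang). Up to sign such a \<open>u\<close> is a boundary vector,
  and \<open>u u\<^sup>T\<close> does not see the sign. So on the hyperplane \<open>J \<bullet> X = 0\<close> the smallest of the three
  completely positive cones already exhausts the positive semidefinite cone, which proves both
  claims for all three choices of the cone at once.
\<close>

section \<open>Rank-one matrices and completely positive cones\<close>

lemma outer_mult_vec: "outer u *v x = (u \<bullet> x) *\<^sub>R u"
  by (simp add: vec_eq_iff outer_def matrix_vector_mult_def inner_vec_def
      sum_distrib_left mult_ac)

lemma inner_outer: "M \<bullet> outer u = u \<bullet> (M *v u)"
  by (simp add: outer_def matrix_vector_mult_def inner_vec_def sum_distrib_left mult_ac)

lemma outer_minus: "outer (- u) = outer u"
  by (simp add: outer_def)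

lemma cp_coneI:
  assumes "finite I" "\<And>i. i \<in> I \<Longrightarrow> u i \<in> C"
  shows "(\<Sum>i\<in>I. outer (u i)) \<in> cp_cone C"
proof -
  obtain h where h: "bij_betw h {..<card I} I"
    using ex_bij_betw_nat_finite[OF assms(1)] by (auto simp: atLeast0LessThan)
  then have "(\<Sum>i\<in>I. outer (u i)) = (\<Sum>l<card I. outer (u (h l)))"
    by (rule sum.reindex_bij_betw[symmetric])
  moreover have "\<forall>l<card I. u (h l) \<in> C"
    using h assms(2) by (auto simp: bij_betw_def)
  ultimately show ?thesis
    unfolding cp_cone_def by (intro CollectI exI[of _ "card I"] exI[of _ "\<lambda>l. u (h l)"]) simp
qed

lemma cp_coneE:
  assumes "X \<in> cp_cone C"
  obtains m :: nat and u where "X = (\<Sum>l<m. outer (u l))" "\<And>l. l < m \<Longrightarrow> u l \<in> C"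
proof -
  from assms have "\<exists>(m :: nat) u. X = (\<Sum>l<m. outer (u l)) \<and> (\<forall>l<m. u l \<in> C)"
    by (simp add: cp_cone_def)
  then show thesis
    using that by metis
qed

lemma cp_cone_mono: "C \<subseteq> D \<Longrightarrow> cp_cone C \<subseteq> cp_cone D"
  unfolding cp_cone_def by blast

lemma cp_cone_zero: "0 \<in> cp_cone C"
  using cp_coneI[of "{}" _ C] by simp

lemma cp_cone_add_outer:
  assumes "X \<in> cp_cone C" "w \<in> C"
  shows "X + outer w \<in> cp_cone C"
proof -
  obtain m :: nat and u where u: "X = (\<Sum>l<m. outer (u l))" "\<And>l. l < m \<Longrightarrow> u l \<in> C"
    using assms(1) by (rule cp_coneE) (rule that)
  let ?u = "u(m := w)"
  have "X + outer w = (\<Sum>l<Suc m. outer (?u l))"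
    using u(1) by simp
  moreover have "(\<Sum>l<Suc m. outer (?u l)) \<in> cp_cone C"
    using u(2) assms(2) by (intro cp_coneI) auto
  ultimately show ?thesis by simp
qed

lemma matrix_vector_mult_sum_left:
  "(\<Sum>i\<in>I. F i) *v x = (\<Sum>i\<in>I. F i *v (x :: real ^ 'n))"
  by (induction I rule: infinite_finite_induct) (auto simp: matrix_vector_mult_add_rdistrib)

lemma matrix_vector_mult_minus_left: "(- A) *v x = - (A *v (x :: real ^ 'n))"
  by (simp add: vec_eq_iff matrix_vector_mult_def sum_negf)

lemma cp_cone_subset_psd: "cp_cone C \<subseteq> psd_cone"
proof
  fix X assume "X \<in> cp_cone C"
  then obtain m :: nat and u where X: "X = (\<Sum>l<m. outer (u l))"
    by (rule cp_coneE)
  have "transpose X = X"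
    unfolding X by (simp add: vec_eq_iff transpose_def outer_def mult.commute)
  moreover have "v \<bullet> (X *v v) \<ge> 0" for v
    unfolding X
    by (simp add: matrix_vector_mult_sum_left outer_mult_vec inner_sum_right inner_commute sum_nonneg)
  ultimately show "X \<in> psd_cone"
    by (simp add: psd_cone_def)
qed

section \<open>Positive semidefinite matrices are sums of rank-one matrices\<close>

lemma nth_eq_inner_axis: "X $ i $ j = axis i 1 \<bullet> (X *v axis j (1::real))"
  by (simp add: inner_axis' matrix_vector_mult_basis column_def)

lemma symmetric_inner_commute:
  fixes X :: "real ^ 'n ^ 'n"
  assumes "transpose X = X"
  shows "v \<bullet> (X *v w) = w \<bullet> (X *v v)"
  by (metis assms dot_lmul_matrix inner_commute transpose_matrix_vector)

text \<open>
  One step of symmetric Gaussian elimination. The value at \<open>v\<close> of the form of the reduced matrix is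
  the value of the original form at \<open>v - t e\<^sub>i\<close> for the minimising \<open>t\<close>, hence nonnegative.
\<close>

lemma psd_eliminate:
  fixes X :: "real ^ 'n ^ 'n"
  assumes X: "X \<in> psd_cone" and pos: "X $ i $ i > 0"
  defines "w \<equiv> (1 / sqrt (X $ i $ i)) *\<^sub>R (X *v axis i 1)"
  shows "X - outer w \<in> psd_cone"
    and "(X - outer w) $ i $ i = 0"
    and "(X - outer w) $ j $ j \<le> X $ j $ j"
proof -
  let ?e = "axis i 1 :: real ^ 'n"
  have sym: "transpose X = X" and nonneg: "\<And>v. v \<bullet> (X *v v) \<ge> 0"
    using X by (auto simp: psd_cone_def)
  have w_nth: "w $ j = X $ j $ i / sqrt (X $ i $ i)" for j
    by (simp add: w_def matrix_vector_mult_basis column_def)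
  have "v \<bullet> ((X - outer w) *v v) \<ge> 0" for v
  proof -
    define t where "t = (v \<bullet> (X *v ?e)) / X $ i $ i"
    have wv: "w \<bullet> v = (v \<bullet> (X *v ?e)) / sqrt (X $ i $ i)"
      by (simp add: w_def inner_commute)
    have "0 \<le> (v - t *\<^sub>R ?e) \<bullet> (X *v (v - t *\<^sub>R ?e))"
      by (rule nonneg)
    also have "\<dots> = v \<bullet> (X *v v) - t * (?e \<bullet> (X *v v)) - t * (v \<bullet> (X *v ?e))
        + t * t * (?e \<bullet> (X *v ?e))"
      by (simp add: matrix_vector_mult_diff_distrib matrix_vector_mult_scaleR inner_diff_left
          inner_diff_right algebra_simps)
    also have "?e \<bullet> (X *v v) = v \<bullet> (X *v ?e)"
      by (rule symmetric_inner_commute[OF sym])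
    also have "?e \<bullet> (X *v ?e) = X $ i $ i"
      by (simp add: nth_eq_inner_axis)
    also have "v \<bullet> (X *v v) - t * (v \<bullet> (X *v ?e)) - t * (v \<bullet> (X *v ?e)) + t * t * X $ i $ i
        = v \<bullet> (X *v v) - (w \<bullet> v)\<^sup>2"
      using pos unfolding t_def wv by (simp add: power_divide power2_eq_square field_simps)
    also have "\<dots> = v \<bullet> ((X - outer w) *v v)"
      by (simp add: matrix_vector_mult_diff_rdistrib outer_mult_vec inner_diff_right
          power2_eq_square inner_commute)
    finally show ?thesis .
  qed
  moreover have "transpose (X - outer w) = X - outer w"
    using sym by (simp add: vec_eq_iff transpose_def outer_def mult.commute)
  ultimately show "X - outer w \<in> psd_cone"
    by (simp add: psd_cone_def)
  show "(X - outer w) $ i $ i = 0"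
    using pos by (simp add: outer_def w_nth)
  show "(X - outer w) $ j $ j \<le> X $ j $ j"
    by (simp add: outer_def)
qed

lemma psd_diag_nonneg: "X \<in> psd_cone \<Longrightarrow> X $ i $ i \<ge> 0"
  by (simp add: psd_cone_def nth_eq_inner_axis)

text \<open>
  If the diagonal vanishes, the form at \<open>e\<^sub>i \<plusminus> e\<^sub>j\<close> is \<open>\<plusminus> 2 X\<^sub>i\<^sub>j\<close>, and both signs must be
  nonnegative.
\<close>

lemma psd_zero_diag:
  fixes X :: "real ^ 'n ^ 'n"
  assumes X: "X \<in> psd_cone" and diag: "\<And>i. X $ i $ i = 0"
  shows "X = 0"
proof -
  have "X $ i $ j = 0" for i j
  proof -
    have sym: "X $ j $ i = X $ i $ j"
      using X by (metis (mono_tags, lifting) mem_Collect_eq psd_cone_def transpose_def vec_lambda_beta)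
    have *: "(axis i 1 + s *\<^sub>R axis j 1) \<bullet> (X *v (axis i 1 + s *\<^sub>R axis j 1)) =
        X $ i $ i + s * X $ i $ j + s * X $ j $ i + s * s * X $ j $ j" for s
      unfolding nth_eq_inner_axis
      by (simp add: matrix_vector_right_distrib matrix_vector_mult_scaleR inner_add_left
          inner_add_right algebra_simps)
    have "0 \<le> X $ i $ i + s * X $ i $ j + s * X $ j $ i + s * s * X $ j $ j" for s
      using X unfolding *[symmetric] psd_cone_def by blast
    from this[of 1] this[of "-1"] show ?thesis
      by (simp add: diag sym)
  qed
  then show ?thesis
    by (simp add: vec_eq_iff)
qed

text \<open>
  Each elimination step splits off one rank-one matrix and clears a diagonal entry while keeping the
  zero ones, so the number of nonzero diagonal entries drops.
\<close>

lemma psd_cone_eq_cp_cone: "psd_cone = cp_cone UNIV"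
proof
  show "psd_cone \<subseteq> (cp_cone UNIV :: (real ^ 'n ^ 'n) set)"
  proof
    fix X :: "real ^ 'n ^ 'n"
    assume "X \<in> psd_cone"
    then show "X \<in> cp_cone UNIV"
    proof (induction "card {i. X $ i $ i \<noteq> 0}" arbitrary: X rule: less_induct)
      case less
      show ?case
      proof (cases "\<forall>i. X $ i $ i = 0")
        case True
        then show ?thesis
          using psd_zero_diag[OF less.prems] by (simp add: cp_cone_zero)
      next
        case False
        then obtain i where i: "X $ i $ i > 0"
          using psd_diag_nonneg[OF less.prems] by (metis less_eq_real_def)
        define w where "w = (1 / sqrt (X $ i $ i)) *\<^sub>R (X *v axis i 1)"
        let ?Y = "X - outer w"
        note elim = psd_eliminate[OF less.prems i, folded w_def]
        have "?Y $ j $ j = 0" if "X $ j $ j = 0" for j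
          using elim(3)[of j] psd_diag_nonneg[OF elim(1), of j] that by simp
        then have "{j. ?Y $ j $ j \<noteq> 0} \<subset> {j. X $ j $ j \<noteq> 0}"
          using elim(2) i by (metis (mono_tags, lifting) mem_Collect_eq less_irrefl psubsetI subsetI)
        then have "card {j. ?Y $ j $ j \<noteq> 0} < card {j. X $ j $ j \<noteq> 0}"
          by (intro psubset_card_mono) auto
        then have "?Y \<in> cp_cone UNIV"
          using less.hyps elim(1) by blast
        then show ?thesis
          using cp_cone_add_outer[of ?Y UNIV w] by simp
      qed
    qed
  qed
qed (rule cp_cone_subset_psd)

section \<open>Rank-one decompositions along which a linear functional vanishes\<close>

text \<open>
  Rotating the pair \<open>(a, b)\<close> in the plane of indices leaves \<open>a a\<^sup>T + b b\<^sup>T\<close> unchanged. If the form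
  of \<open>M\<close> has opposite signs at \<open>a\<close> and \<open>b\<close>, it vanishes at some \<open>a + t b\<close>, because the quadratic in
  \<open>t\<close> has positive discriminant.
\<close>

lemma rotate_outer_pair:
  fixes M :: "real ^ 'n ^ 'n"
  assumes a: "a \<bullet> (M *v a) > 0" and b: "b \<bullet> (M *v b) < 0"
  obtains p r where "outer p + outer r = outer a + outer b" "p \<bullet> (M *v p) = 0"
proof -
  let ?\<beta> = "a \<bullet> (M *v b) + b \<bullet> (M *v a)"
  have "discrim (b \<bullet> (M *v b)) ?\<beta> (a \<bullet> (M *v a)) > 0"
    using mult_neg_pos[OF b a] zero_le_power2[of ?\<beta>] unfolding discrim_def by linarith
  then obtain t where t: "(b \<bullet> (M *v b)) * t\<^sup>2 + ?\<beta> * t + a \<bullet> (M *v a) = 0"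
    using discriminant_pos_ex[of "b \<bullet> (M *v b)" ?\<beta> "a \<bullet> (M *v a)"] b by auto
  define s where "s = 1 / sqrt (1 + t\<^sup>2)"
  have s: "s\<^sup>2 * (1 + t\<^sup>2) = 1"
  proof -
    have "1 + t\<^sup>2 > 0" by (simp add: add_pos_nonneg)
    then show ?thesis by (simp add: s_def power_divide)
  qed
  show ?thesis
  proof (rule that)
    have "(s * (x + t * y)) * (s * (x' + t * y')) + (s * (y - t * x)) * (s * (y' - t * x'))
        = x * x' + y * y'" for x y x' y' :: real
    proof -
      have "(s * (x + t * y)) * (s * (x' + t * y')) + (s * (y - t * x)) * (s * (y' - t * x'))
          = s\<^sup>2 * (1 + t\<^sup>2) * (x * x' + y * y')"
        by (simp add: algebra_simps power2_eq_square)
      then show ?thesis by (simp add: s)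
    qed
    then show "outer (s *\<^sub>R (a + t *\<^sub>R b)) + outer (s *\<^sub>R (b - t *\<^sub>R a)) = outer a + outer b"
      by (simp add: vec_eq_iff outer_def)
    have "(a + t *\<^sub>R b) \<bullet> (M *v (a + t *\<^sub>R b)) = 0"
      using t by (simp add: matrix_vector_right_distrib matrix_vector_mult_scaleR inner_add_left
          inner_add_right algebra_simps power2_eq_square)
    then show "(s *\<^sub>R (a + t *\<^sub>R b)) \<bullet> (M *v (s *\<^sub>R (a + t *\<^sub>R b))) = 0"
      by (simp add: matrix_vector_mult_scaleR)
  qed
qed

text \<open>
  As long as some summand has a nonzero value, the values summing to zero yield two summands of
  opposite sign. Rotating these makes one value zero, so the number of nonzero values drops.
\<close>

lemma rank_one_decomposition_sum:
  fixes M :: "real ^ 'n ^ 'n"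
  assumes "finite I" "M \<bullet> (\<Sum>i\<in>I. outer (u i)) = 0"
  shows "\<exists>v. (\<Sum>i\<in>I. outer (v i)) = (\<Sum>i\<in>I. outer (u i)) \<and> (\<forall>i\<in>I. v i \<bullet> (M *v v i) = 0)"
  using assms(2)
proof (induction "card {i\<in>I. u i \<bullet> (M *v u i) \<noteq> 0}" arbitrary: u rule: less_induct)
  case less
  let ?q = "\<lambda>x. x \<bullet> (M *v x)"
  have sum0: "(\<Sum>i\<in>I. ?q (u i)) = 0"
    using less.prems by (simp add: inner_sum_right inner_outer)
  show ?case
  proof (cases "\<forall>i\<in>I. ?q (u i) = 0")
    case True
    then show ?thesis by blast
  next
    case False
    have "\<exists>i\<in>I. ?q (u i) > 0"
    proof (rule ccontr)
      assume "\<not> ?thesis"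
      then have "\<And>i. i \<in> I \<Longrightarrow> 0 \<le> - ?q (u i)" by force
      then have "\<forall>i\<in>I. - ?q (u i) = 0"
        using sum_nonneg_eq_0_iff[OF \<open>finite I\<close>, of "\<lambda>i. - ?q (u i)"] sum0
        by (simp add: sum_negf)
      then show False using False by simp
    qed
    moreover have "\<exists>j\<in>I. ?q (u j) < 0"
    proof (rule ccontr)
      assume "\<not> ?thesis"
      then have "\<And>i. i \<in> I \<Longrightarrow> 0 \<le> ?q (u i)" by force
      then show False
        using sum_nonneg_eq_0_iff[OF \<open>finite I\<close>, of "\<lambda>i. ?q (u i)"] sum0 False by blast
    qed
    ultimately obtain i j where ij: "i \<in> I" "j \<in> I" "?q (u i) > 0" "?q (u j) < 0"
      by blast
    then have "i \<noteq> j" by auto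
    obtain p r where pr: "outer p + outer r = outer (u i) + outer (u j)" "?q p = 0"
      using rotate_outer_pair[OF ij(3,4)] by blast
    let ?u = "u(i := p, j := r)"
    have split: "(\<Sum>l\<in>I. outer (f l)) = outer (f i) + outer (f j) + (\<Sum>l\<in>I-{i}-{j}. outer (f l))"
      for f :: "_ \<Rightarrow> real ^ 'n"
      using ij(1,2) \<open>i \<noteq> j\<close> \<open>finite I\<close>
        sum.remove[of I i "\<lambda>l. outer (f l)"] sum.remove[of "I - {i}" j "\<lambda>l. outer (f l)"]
      by (simp add: add.assoc)
    have "(\<Sum>l\<in>I-{i}-{j}. outer (?u l)) = (\<Sum>l\<in>I-{i}-{j}. outer (u l))"
      by (rule sum.cong) auto
    then have same: "(\<Sum>l\<in>I. outer (?u l)) = (\<Sum>l\<in>I. outer (u l))"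
      using pr(1) \<open>i \<noteq> j\<close> unfolding split by simp
    have "{l\<in>I. ?q (?u l) \<noteq> 0} \<subset> {l\<in>I. ?q (u l) \<noteq> 0}"
    proof (rule psubsetI)
      show "{l\<in>I. ?q (?u l) \<noteq> 0} \<subseteq> {l\<in>I. ?q (u l) \<noteq> 0}"
        using ij pr(2) by auto
      have "i \<in> {l\<in>I. ?q (u l) \<noteq> 0}" "i \<notin> {l\<in>I. ?q (?u l) \<noteq> 0}"
        using ij pr(2) \<open>i \<noteq> j\<close> by auto
      then show "{l\<in>I. ?q (?u l) \<noteq> 0} \<noteq> {l\<in>I. ?q (u l) \<noteq> 0}"
        by blast
    qed
    then have "card {l\<in>I. ?q (?u l) \<noteq> 0} < card {l\<in>I. ?q (u l) \<noteq> 0}"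
      using \<open>finite I\<close> by (intro psubset_card_mono) auto
    then have "\<exists>v. (\<Sum>l\<in>I. outer (v l)) = (\<Sum>l\<in>I. outer (?u l)) \<and>
        (\<forall>l\<in>I. v l \<bullet> (M *v v l) = 0)"
      using less.prems by (intro less.hyps) (simp_all only: same)
    then show ?thesis
      by (simp only: same)
  qed
qed

lemma rank_one_decomposition:
  fixes M X :: "real ^ 'n ^ 'n"
  assumes "X \<in> psd_cone" "M \<bullet> X = 0"
  shows "X \<in> cp_cone {u. u \<bullet> (M *v u) = 0}"
proof -
  obtain m :: nat and u where X: "X = (\<Sum>l<m. outer (u l))"
    using assms(1) unfolding psd_cone_eq_cp_cone by (rule cp_coneE)
  then obtain v where v: "(\<Sum>l<m. outer (v l)) = X" "\<forall>l\<in>{..<m}. v l \<bullet> (M *v v l) = 0"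
    using rank_one_decomposition_sum[of "{..<m}" M u] assms(2) by auto
  have "(\<Sum>l<m. outer (v l)) \<in> cp_cone {u. u \<bullet> (M *v u) = 0}"
    using v(2) by (intro cp_coneI) auto
  then show ?thesis by (simp only: v(1))
qed

section \<open>The second order cone and the reflection \<open>J\<close>\<close>

lemma Jmat_mult_vec: "Jmat k *v x = (2 * x $ k) *\<^sub>R axis k 1 - x"
proof -
  have "(Jmat k *v x) $ i = (\<Sum>j\<in>UNIV. if i = j then (if i = k then 1 else - 1) * x $ j else 0)" for i
    by (simp only: Jmat_def matrix_vector_mult_def vec_lambda_beta) (rule sum.cong, auto)
  then show ?thesis
    by (simp add: vec_eq_iff axis_def)
qed

lemma Jmat_mult_nth: "(Jmat k ** X) $ i $ j = (if i = k then 1 else - 1) * X $ i $ j"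
proof -
  have "(Jmat k ** X) $ i $ j = (\<Sum>l\<in>UNIV. if i = l then (if i = k then 1 else - 1) * X $ l $ j else 0)"
    by (simp only: Jmat_def matrix_matrix_mult_def vec_lambda_beta) (rule sum.cong, auto)
  then show ?thesis by simp
qed

lemma Jmat_inner_swap: "(Jmat k ** X) \<bullet> Y = X \<bullet> (Jmat k ** Y)"
  by (simp add: inner_vec_def Jmat_mult_nth mult_ac)

lemma Jmat_involution: "Jmat k ** (Jmat k ** X) = X"
  by (simp add: vec_eq_iff Jmat_mult_nth)

lemma Jmat_vec_inner_swap: "(Jmat k *v x) \<bullet> y = x \<bullet> (Jmat k *v y)"
  by (simp add: Jmat_mult_vec inner_diff_left inner_diff_right inner_axis inner_axis')

lemma Jmat_vec_involution: "Jmat k *v (Jmat k *v x) = x"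
  by (simp add: Jmat_mult_vec vec_eq_iff axis_def)

lemma Jmat_quadratic_form: "x \<bullet> (Jmat k *v x) = 2 * (x $ k)\<^sup>2 - x \<bullet> x"
  by (simp add: Jmat_mult_vec inner_diff_right inner_axis power2_eq_square)

lemma L2_set_off_squared: "(L2_set (\<lambda>i. x $ i) (UNIV - {k}))\<^sup>2 = x \<bullet> x - (x $ k)\<^sup>2"
proof -
  have "x \<bullet> x = (\<Sum>i\<in>UNIV. (x $ i)\<^sup>2)"
    by (simp add: inner_vec_def power2_eq_square)
  also have "\<dots> = (x $ k)\<^sup>2 + (\<Sum>i\<in>UNIV - {k}. (x $ i)\<^sup>2)"
    by (rule sum.remove) auto
  finally show ?thesis
    by (simp add: L2_set_def sum_nonneg)
qed

lemma soc_iff: "x \<in> soc k \<longleftrightarrow> x $ k \<ge> 0 \<and> x \<bullet> (Jmat k *v x) \<ge> 0"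
proof -
  let ?N = "L2_set (\<lambda>i. x $ i) (UNIV - {k})"
  have "?N \<le> x $ k \<longleftrightarrow> x $ k \<ge> 0 \<and> ?N\<^sup>2 \<le> (x $ k)\<^sup>2"
    by (meson L2_set_nonneg order_trans power2_le_imp_le power_mono)
  then show ?thesis
    unfolding soc_def L2_set_off_squared Jmat_quadratic_form by auto
qed

lemma soc_boundary_iff: "x \<in> soc_boundary k \<longleftrightarrow> x $ k \<ge> 0 \<and> x \<bullet> (Jmat k *v x) = 0"
proof -
  let ?N = "L2_set (\<lambda>i. x $ i) (UNIV - {k})"
  have "x $ k = ?N \<longleftrightarrow> x $ k \<ge> 0 \<and> ?N\<^sup>2 = (x $ k)\<^sup>2"
    using L2_set_nonneg[of "\<lambda>i. x $ i" "UNIV - {k}"] by (metis power2_eq_iff_nonneg)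
  then show ?thesis
    unfolding soc_boundary_def L2_set_off_squared Jmat_quadratic_form by auto
qed

text \<open>By Cauchy-Schwarz on the components other than \<open>k\<close>, these contribute at least \<open>- x\<^sub>k y\<^sub>k\<close>.\<close>

lemma soc_inner_nonneg:
  assumes x: "x \<in> soc k" and y: "y \<in> soc k"
  shows "x \<bullet> y \<ge> 0"
proof -
  let ?N = "\<lambda>x :: real ^ 'a. L2_set (\<lambda>i. x $ i) (UNIV - {k})"
  have "\<bar>\<Sum>i\<in>UNIV - {k}. x $ i * y $ i\<bar> \<le> (\<Sum>i\<in>UNIV - {k}. \<bar>x $ i\<bar> * \<bar>y $ i\<bar>)"
    by (rule order_trans[OF sum_abs]) (simp add: abs_mult)
  also have "\<dots> \<le> ?N x * ?N y"
    by (rule L2_set_mult_ineq)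
  also have "\<dots> \<le> x $ k * y $ k"
    using x y unfolding soc_def by (auto intro!: mult_mono intro: order_trans[OF L2_set_nonneg])
  finally have "- (x $ k * y $ k) \<le> (\<Sum>i\<in>UNIV - {k}. x $ i * y $ i)"
    by linarith
  moreover have "x \<bullet> y = x $ k * y $ k + (\<Sum>i\<in>UNIV - {k}. x $ i * y $ i)"
    unfolding inner_vec_def by (simp add: sum.remove[of UNIV k])
  ultimately show ?thesis by linarith
qed

lemma Jmat_vec_soc_iff: "Jmat k *v x \<in> soc k \<longleftrightarrow> x \<in> soc k"
  unfolding soc_iff Jmat_vec_involution
  by (simp add: inner_commute) (simp add: Jmat_mult_vec)

text \<open>
  For the inclusion of the dual in the cone, a dual vector \<open>y = (s, w)\<close> is tested against \<open>(1, 0)\<close>,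
  giving \<open>s \<ge> 0\<close>, and against \<open>(\<parallel>w\<parallel>, - w)\<close>, giving \<open>s \<parallel>w\<parallel> \<ge> \<parallel>w\<parallel>\<^sup>2\<close>.
\<close>

lemma soc_self_dual: "dual_cone (soc k) = soc k"
proof
  show "soc k \<subseteq> dual_cone (soc k)"
    by (auto simp: dual_cone_def intro: soc_inner_nonneg)
  show "dual_cone (soc k) \<subseteq> soc k"
  proof
    fix y assume y: "y \<in> dual_cone (soc k)"
    let ?N = "L2_set (\<lambda>i. y $ i) (UNIV - {k})"
    have N: "?N \<ge> 0" by (rule L2_set_nonneg)
    have "axis k 1 \<in> soc k"
      by (simp add: soc_iff Jmat_quadratic_form inner_axis_axis)
    then have yk: "y $ k \<ge> 0"
      using y by (auto simp: dual_cone_def inner_axis)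
    define z where "z = (?N + y $ k) *\<^sub>R axis k 1 - y"
    have z_nth: "z $ k = ?N" "\<And>i. i \<noteq> k \<Longrightarrow> z $ i = - y $ i"
      by (auto simp: z_def axis_def)
    have "L2_set (\<lambda>i. z $ i) (UNIV - {k}) = ?N"
      unfolding L2_set_def using z_nth(2) by (auto intro!: arg_cong[of _ _ sqrt] sum.cong)
    then have "z \<in> soc k"
      by (simp add: soc_def z_nth(1))
    then have "0 \<le> y \<bullet> z"
      using y by (auto simp: dual_cone_def)
    also have "y \<bullet> z = ?N * y $ k - ?N\<^sup>2"
      unfolding L2_set_off_squared
      by (simp add: z_def inner_diff_right inner_axis algebra_simps power2_eq_square)
    finally have "?N * ?N \<le> ?N * y $ k"
      by (simp add: power2_eq_square)
    then have "?N \<le> y $ k"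
      using N yk by (cases "?N = 0") auto
    then show "y \<in> soc k"
      by (simp add: soc_def)
  qed
qed

text \<open>
  Orthogonality gives \<open>J y \<bullet> x = 2 x\<^sub>k y\<^sub>k\<close>, so the vector \<open>x\<^sub>k J y - y\<^sub>k x\<close> has squared norm
  \<open>x\<^sub>k\<^sup>2 \<parallel>y\<parallel>\<^sup>2 + y\<^sub>k\<^sup>2 \<parallel>x\<parallel>\<^sup>2 - 4 x\<^sub>k\<^sup>2 y\<^sub>k\<^sup>2\<close>, which is at most zero
  since \<open>\<parallel>x\<parallel>\<^sup>2 \<le> 2 x\<^sub>k\<^sup>2\<close> and \<open>\<parallel>y\<parallel>\<^sup>2 \<le> 2 y\<^sub>k\<^sup>2\<close> in the cone.
\<close>

lemma soc_orthogonal_pair: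
  assumes x: "x \<in> soc k" "x \<noteq> 0" and y: "y \<in> soc k" and orth: "x \<bullet> y = 0"
  obtains c where "c \<ge> 0" "Jmat k *v y = c *\<^sub>R x"
proof -
  have bounds: "x \<bullet> x \<le> 2 * (x $ k)\<^sup>2" "y \<bullet> y \<le> 2 * (y $ k)\<^sup>2" "x $ k \<ge> 0" "y $ k \<ge> 0"
    using x(1) y by (auto simp: soc_iff Jmat_quadratic_form)
  have "x $ k \<noteq> 0"
  proof
    assume "x $ k = 0"
    then have "x \<bullet> x \<le> 0" using bounds(1) by simp
    then show False using \<open>x \<noteq> 0\<close> by (metis inner_gt_zero_iff not_le)
  qed
  then have xk: "x $ k > 0" using bounds(3) by simp
  let ?d = "x $ k *\<^sub>R (Jmat k *v y) - y $ k *\<^sub>R x"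
  have Jy: "(Jmat k *v y) \<bullet> (Jmat k *v y) = y \<bullet> y"
    by (simp add: Jmat_vec_inner_swap Jmat_vec_involution)
  have Jyx: "(Jmat k *v y) \<bullet> x = 2 * y $ k * x $ k"
    using orth by (simp add: Jmat_mult_vec inner_diff_left inner_axis' inner_commute[of y x])
  have "?d \<bullet> ?d = (x $ k)\<^sup>2 * ((Jmat k *v y) \<bullet> (Jmat k *v y))
      - 2 * (x $ k * y $ k) * ((Jmat k *v y) \<bullet> x) + (y $ k)\<^sup>2 * (x \<bullet> x)"
    by (simp add: inner_diff_left inner_diff_right inner_commute power2_eq_square algebra_simps)
  also have "\<dots> \<le> (x $ k)\<^sup>2 * (2 * (y $ k)\<^sup>2)
      - 2 * (x $ k * y $ k) * (2 * y $ k * x $ k) + (y $ k)\<^sup>2 * (2 * (x $ k)\<^sup>2)"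
    unfolding Jy Jyx using bounds(1,2)
    by (intro add_mono diff_right_mono mult_left_mono) auto
  also have "\<dots> = 0"
    by (simp add: power2_eq_square)
  finally have "?d = 0"
    by (metis inner_gt_zero_iff not_le)
  then have "Jmat k *v y = (y $ k / x $ k) *\<^sub>R x"
    using xk by (simp add: vec_eq_iff field_simps)
  then show ?thesis
    using that[of "y $ k / x $ k"] xk bounds(4) by simp
qed

text \<open>Replacing \<open>u\<close> by \<open>- u\<close> where its component \<open>k\<close> is negative keeps \<open>u u\<^sup>T\<close>.\<close>

lemma cp_cone_soc_boundary: "cp_cone (soc_boundary k) = cp_cone {u. u \<bullet> (Jmat k *v u) = 0}"
proof
  show "cp_cone (soc_boundary k) \<subseteq> cp_cone {u. u \<bullet> (Jmat k *v u) = 0}"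
    by (rule cp_cone_mono) (auto simp: soc_boundary_iff)
  show "cp_cone {u. u \<bullet> (Jmat k *v u) = 0} \<subseteq> cp_cone (soc_boundary k)"
  proof
    fix X assume "X \<in> cp_cone {u. u \<bullet> (Jmat k *v u) = 0}"
    then obtain m :: nat and u where u: "X = (\<Sum>l<m. outer (u l))"
        "\<And>l. l < m \<Longrightarrow> u l \<in> {u. u \<bullet> (Jmat k *v u) = 0}"
      by (rule cp_coneE) (rule that)
    let ?v = "\<lambda>l. if u l $ k \<ge> 0 then u l else - u l"
    have "X = (\<Sum>l<m. outer (?v l))"
      unfolding u(1) by (rule sum.cong) (auto simp: outer_minus)
    moreover have "(\<Sum>l<m. outer (?v l)) \<in> cp_cone (soc_boundary k)"
      using u(2) by (intro cp_coneI) (auto simp: soc_boundary_iff Jmat_quadratic_form)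
    ultimately show "X \<in> cp_cone (soc_boundary k)" by simp
  qed
qed

section \<open>The dual of the cone of \<open>Z\<close>-transformations\<close>

lemma Z_transformations_soc_iff:
  "A \<in> Z_transformations (soc k) \<longleftrightarrow> (\<forall>x\<in>soc_boundary k. x \<bullet> ((- (Jmat k ** A)) *v x) \<ge> 0)"
proof -
  have form: "x \<bullet> ((- (Jmat k ** A)) *v x) = - ((A *v x) \<bullet> (Jmat k *v x))" for x
    using Jmat_vec_inner_swap[of k "A *v x" x]
    by (simp add: matrix_vector_mult_minus_left matrix_vector_mul_assoc inner_commute)
  show ?thesis
    unfolding form
  proof
    assume A: "A \<in> Z_transformations (soc k)"
    show "\<forall>x\<in>soc_boundary k. - ((A *v x) \<bullet> (Jmat k *v x)) \<ge> 0"
    proof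
      fix x assume x: "x \<in> soc_boundary k"
      then have "x \<in> soc k" "Jmat k *v x \<in> dual_cone (soc k)" "x \<bullet> (Jmat k *v x) = 0"
        unfolding soc_self_dual Jmat_vec_soc_iff by (auto simp: soc_boundary_iff soc_iff)
      then show "- ((A *v x) \<bullet> (Jmat k *v x)) \<ge> 0"
        using A by (auto simp: Z_transformations_def)
    qed
  next
    assume A: "\<forall>x\<in>soc_boundary k. - ((A *v x) \<bullet> (Jmat k *v x)) \<ge> 0"
    have "(A *v x) \<bullet> y \<le> 0" if xy: "x \<in> soc k" "y \<in> soc k" "x \<bullet> y = 0" for x y
    proof (cases "x = 0")
      case False
      then obtain c where c: "c \<ge> 0" "Jmat k *v y = c *\<^sub>R x"
        using soc_orthogonal_pair xy by blast
      have y: "y = c *\<^sub>R (Jmat k *v x)"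
        using c(2) Jmat_vec_involution[of k y] by (simp add: matrix_vector_mult_scaleR)
      show ?thesis
      proof (cases "c = 0")
        case False
        then have "x \<in> soc_boundary k"
          using xy(1,3) y by (simp add: soc_boundary_iff soc_iff)
        then have "(A *v x) \<bullet> (Jmat k *v x) \<le> 0"
          using A by auto
        then show ?thesis
          using c(1) unfolding y by (simp add: mult_nonneg_nonpos)
      qed (simp add: y)
    qed simp
    then show "A \<in> Z_transformations (soc k)"
      by (auto simp: Z_transformations_def soc_self_dual)
  qed
qed

text \<open>
  Necessity comes from the test matrices \<open>M = \<plusminus> J\<close>, \<open>M = v v\<^sup>T\<close> and \<open>M = X\<^sup>T - X\<close>. The last one,
  being skew, has zero quadratic form, and it yields symmetry because
  \<open>X \<bullet> (X\<^sup>T - X) = - \<parallel>X\<^sup>T - X\<parallel>\<^sup>2 / 2\<close>. Sufficiency holds because \<open>X\<close> decomposes into matrices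
  \<open>u u\<^sup>T\<close> with \<open>u\<close> on the boundary, and \<open>u u\<^sup>T \<bullet> M\<close> is the value of the form of \<open>M\<close> at \<open>u\<close>.
\<close>

lemma dual_of_boundary_copositive:
  fixes X :: "real ^ 'n ^ 'n"
  shows "(\<forall>M. (\<forall>x\<in>soc_boundary k. x \<bullet> (M *v x) \<ge> 0) \<longrightarrow> X \<bullet> M \<ge> 0) \<longleftrightarrow>
    Jmat k \<bullet> X = 0 \<and> X \<in> psd_cone" (is "?L \<longleftrightarrow> ?R")
proof
  assume ?L
  then have test: "X \<bullet> M \<ge> 0" if "\<And>x. x \<in> soc_boundary k \<Longrightarrow> x \<bullet> (M *v x) \<ge> 0" for M
    using that by blast
  have "X \<bullet> Jmat k \<ge> 0" "X \<bullet> - Jmat k \<ge> 0"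
    by (rule test; simp add: soc_boundary_iff matrix_vector_mult_minus_left)+
  then have "Jmat k \<bullet> X = 0"
    by (simp add: inner_commute)
  moreover have "v \<bullet> (X *v v) \<ge> 0" for v
    unfolding inner_outer[symmetric]
    by (rule test) (simp add: outer_mult_vec inner_commute)
  moreover have "transpose X = X"
  proof -
    have "x \<bullet> ((transpose X - X) *v x) = 0" for x
      using dot_lmul_matrix[of x X x]
      by (simp add: matrix_vector_mult_diff_rdistrib inner_diff_right inner_commute)
    then have "X \<bullet> (transpose X - X) \<ge> 0"
      by (intro test) simp
    moreover have "transpose X \<bullet> transpose X = X \<bullet> X"
      unfolding inner_vec_def transpose_def by (simp, rule sum.swap)
    then have "(transpose X - X) \<bullet> (transpose X - X) = - 2 * (X \<bullet> (transpose X - X))"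
      by (simp add: inner_diff_left inner_diff_right inner_commute)
    ultimately have "(transpose X - X) \<bullet> (transpose X - X) \<le> 0"
      by simp
    then have "transpose X - X = 0"
      by (metis inner_gt_zero_iff not_le)
    then show ?thesis by simp
  qed
  ultimately show ?R
    by (simp add: psd_cone_def)
next
  assume ?R
  then have "X \<in> cp_cone (soc_boundary k)"
    unfolding cp_cone_soc_boundary by (intro rank_one_decomposition) auto
  then obtain m :: nat and u where u: "X = (\<Sum>l<m. outer (u l))"
      "\<And>l. l < m \<Longrightarrow> u l \<in> soc_boundary k"
    by (rule cp_coneE) (rule that)
  show ?L
  proof (intro allI impI)
    fix M assume M: "\<forall>x\<in>soc_boundary k. x \<bullet> (M *v x) \<ge> 0"
    have "X \<bullet> M = (\<Sum>l<m. u l \<bullet> (M *v u l))"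
      unfolding u(1) inner_commute[of _ M] by (simp add: inner_sum_right inner_outer)
    then show "X \<bullet> M \<ge> 0"
      using M u(2) by (auto intro!: sum_nonneg)
  qed
qed

lemma dual_cone_Z_transformations_soc_iff:
  "B \<in> dual_cone (Z_transformations (soc k)) \<longleftrightarrow>
    Jmat k \<bullet> - (Jmat k ** B) = 0 \<and> - (Jmat k ** B) \<in> psd_cone"
proof -
  let ?P = "\<lambda>M. \<forall>x\<in>soc_boundary k. x \<bullet> (M *v x) \<ge> 0"
  have pair: "- (Jmat k ** B) \<bullet> M = B \<bullet> - (Jmat k ** M)" for M
    by (simp add: Jmat_inner_swap)
  have inv: "- (Jmat k ** - (Jmat k ** M)) = M" for M :: "real ^ 'a ^ 'a"
    by (simp add: vec_eq_iff Jmat_mult_nth)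
  have "B \<in> dual_cone (Z_transformations (soc k)) \<longleftrightarrow> (\<forall>A. ?P (- (Jmat k ** A)) \<longrightarrow> B \<bullet> A \<ge> 0)"
    by (auto simp: dual_cone_def Z_transformations_soc_iff)
  \<comment> \<open>The involution \<open>A \<mapsto> - J A\<close> turns \<open>Z\<close>-transformations into copositive matrices.\<close>
  also have "\<dots> \<longleftrightarrow> (\<forall>M. ?P M \<longrightarrow> - (Jmat k ** B) \<bullet> M \<ge> 0)"
    unfolding pair by (metis inv)
  finally show ?thesis
    by (simp only: dual_of_boundary_copositive)
qed

text \<open>
  The three cones are nested between the boundary and the whole space, so their completely positive
  cones lie between the smallest, which the rank-one decomposition reaches, and the largest, which
  is the positive semidefinite cone.
\<close>

lemma psd_cone_eq_cp_cone_on_hyperplane: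
  assumes "C = UNIV \<or> C = soc k \<or> C = soc_boundary k" "Jmat k \<bullet> X = 0"
  shows "X \<in> psd_cone \<longleftrightarrow> X \<in> cp_cone C"
proof
  assume "X \<in> psd_cone"
  then have "X \<in> cp_cone (soc_boundary k)"
    unfolding cp_cone_soc_boundary using assms(2) by (rule rank_one_decomposition)
  moreover have "soc_boundary k \<subseteq> C"
    using assms(1) by (auto simp: soc_boundary_iff soc_iff)
  ultimately show "X \<in> cp_cone C"
    using cp_cone_mono by blast
qed (use cp_cone_subset_psd in blast)

theorem theorem3p2:
  fixes k :: "'n::finite" and C :: "(real ^ 'n) set"
  assumes "CARD('n) > 1"
    and "C = UNIV \<or> C = soc k \<or> C = soc_boundary k"
  shows "dual_cone (Z_transformations (soc k)) =
           {B :: real ^ 'n ^ 'n. B \<bullet> mat 1 = 0 \<and> - (Jmat k ** B) \<in> cp_cone C}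
       \<and> {X :: real ^ 'n ^ 'n. Jmat k \<bullet> X = 0 \<and> X \<in> psd_cone} =
           {X. Jmat k \<bullet> X = 0 \<and> X \<in> cp_cone C}"
proof -
  note cp_iff = psd_cone_eq_cp_cone_on_hyperplane[OF assms(2)]
  have J: "Jmat k \<bullet> - (Jmat k ** B) = - (B \<bullet> mat 1)" for B
    using Jmat_inner_swap[of k "mat 1" "Jmat k ** B"] by (simp add: Jmat_involution inner_commute)
  have "B \<in> dual_cone (Z_transformations (soc k)) \<longleftrightarrow>
      B \<bullet> mat 1 = 0 \<and> - (Jmat k ** B) \<in> cp_cone C" for B
    unfolding dual_cone_Z_transformations_soc_iff using J[of B] cp_iff by auto
  then show ?thesis
    using cp_iff by blast
qed

end
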